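(* We have $\operatorname{conv}(Q_{3,2})=\mathcal{S}_{3,2}$, and $\operatorname{conv}(Q_{n,2})\subsetneq\mathcal{S}_{n,2}$ for every integer $n\ge 4$.
   Context: $\mathbb{S}^n$ is the space of real symmetric $n\times n$ matrices, and $A\succeq B$ means that $A-B$ is positive semidefinite. For $X\in\mathbb{S}^n$, $\operatorname{diag}(X)\in\mathbb{S}^n$ is the diagonal matrix with the same diagonal as $X$. $\|x\|_0$ is the number of nonzero entries of $x$. Define $\mathcal{S}_{n,k}=\{X\in\mathbb{S}^n: k\operatorname{diag}(X)\succeq X\succeq 0\}$ and $Q_{n,k}=\{xx^T: x\in\mathbb{R}^n,\ \|x\|_0\le k\}$; $\operatorname{conv}$ denotes convex hull. *)

theory Defs
  imports "HOL-Analysis.Analysis"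
begin

definition symmetric_matrix :: "real^'n^'n \<Rightarrow> bool" where
  "symmetric_matrix A \<longleftrightarrow> transpose A = A"

definition psd :: "real^'n^'n \<Rightarrow> bool" where
  "psd A \<longleftrightarrow> symmetric_matrix A \<and> (\<forall>x. 0 \<le> x \<bullet> (A *v x))"

definition loewner_ge :: "real^'n^'n \<Rightarrow> real^'n^'n \<Rightarrow> bool"  (infix "\<succeq>\<^sub>L" 50) where
  "A \<succeq>\<^sub>L B \<longleftrightarrow> psd (A - B)"

definition diag_part :: "real^'n^'n \<Rightarrow> real^'n^'n" where
  "diag_part X = (\<chi> i j. if i = j then X $ i $ j else 0)"

definition norm0 :: "real^'n \<Rightarrow> nat" where
  "norm0 x = card {i. x $ i \<noteq> 0}"

definition outer_product :: "real^'n \<Rightarrow> real^'n \<Rightarrow> real^'n^'n" where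
  "outer_product x y = (\<chi> i j. x $ i * y $ j)"

text \<open>
  The dimension \<open>n\<close> is the cardinality of the finite index type \<open>'n\<close>, so \<open>S_set k\<close> and
  \<open>Q_set k\<close> at type \<open>(real^'n^'n) set\<close> are $\mathcal{S}_{n,k}$ and $Q_{n,k}$.
\<close>

definition S_set :: "nat \<Rightarrow> (real^'n^'n) set" where
  "S_set k = {X. symmetric_matrix X \<and> real k *\<^sub>R diag_part X \<succeq>\<^sub>L X \<and> X \<succeq>\<^sub>L 0}"

definition Q_set :: "nat \<Rightarrow> (real^'n^'n) set" where
  "Q_set k = {outer_product x x | x. norm0 x \<le> k}"

end

theory Submission
  imports Defs
begin

text \<open>
  The convex hull of \<open>Q_set 2\<close> is the cone of sums of positive semidefinite matrices supported on
  a single \<open>2 \<times> 2\<close> block.  For \<open>n = 3\<close>, let \<open>a, b, c\<close> be the off-diagonal entries of \<open>X\<close>.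
  The matrix \<open>2 diag X - X\<close> has the off-diagonal entries \<open>-a, -b, -c\<close>, so positive
  semidefiniteness of both matrices gives a determinant inequality in which \<open>2abc\<close> is replaced by
  \<open>-2\<bar>abc\<bar>\<close>; this is nonnegativity of the determinant of the comparison matrix \<open>M\<close> (off-diagonal
  entries \<open>-\<bar>a\<bar>, -\<bar>b\<bar>, -\<bar>c\<bar>\<close>).  A positive vector \<open>v\<close> with \<open>M v \<ge> 0\<close>, taken from the adjugate
  of \<open>M\<close>, tells how to split the diagonal among the three blocks.

  For \<open>n \<ge> 4\<close>, let \<open>A\<close> be the adjacency matrix of a 4-cycle with exactly one negative edge.  Then
  \<open>A\<^sup>2 = 2I\<close>, so \<open>3I \<plusminus> 2A = (I \<plusminus> A)\<^sup>2\<close> are both positive semidefinite and \<open>3I + 2A\<close> lies in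
  \<open>S_set 2\<close>.  The functional \<open>tr Y - \<langle>A, Y\<rangle>\<close> is nonnegative on \<open>Q_set 2\<close>, but
  it is \<open>12 - 16\<close> at \<open>3I + 2A\<close>.
\<close>

section \<open>Matrix entries, quadratic forms and semidefiniteness\<close>

lemma outer_product_nth [simp]: "outer_product x y $ i $ j = x $ i * y $ j"
  by (simp add: outer_product_def)

lemma diag_part_nth [simp]: "diag_part X $ i $ j = (if i = j then X $ i $ j else 0)"
  by (simp add: diag_part_def)

lemma inner_outer_product: "x \<bullet> (outer_product u u *v x) = (u \<bullet> x)\<^sup>2"
proof -
  have "outer_product u u *v x = (u \<bullet> x) *\<^sub>R u"
    by (simp add: vec_eq_iff matrix_vector_mult_def inner_vec_def sum_distrib_left sum_distrib_right
        mult_ac)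
  then show ?thesis
    by (simp add: power2_eq_square inner_commute)
qed

lemma inner_diag_part: "x \<bullet> (diag_part X *v x) = (\<Sum>i\<in>UNIV. X $ i $ i * (x $ i)\<^sup>2)"
  by (simp add: matrix_vector_mult_def inner_vec_def if_distrib if_distribR
      power2_eq_square mult_ac cong: if_cong)

lemma psd_outer_product: "psd (outer_product x x)"
  by (simp add: psd_def symmetric_matrix_def transpose_def vec_eq_iff inner_outer_product)

lemma psd_add: "psd A \<Longrightarrow> psd B \<Longrightarrow> psd (A + B)"
  by (simp add: psd_def symmetric_matrix_def transpose_def vec_eq_iff
      matrix_vector_mult_add_rdistrib inner_add_right)

lemma psd_scaleR: "0 \<le> c \<Longrightarrow> psd A \<Longrightarrow> psd (c *\<^sub>R A)"
  by (simp add: psd_def symmetric_matrix_def transpose_def vec_eq_iff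
      scaleR_matrix_vector_assoc [symmetric])

lemma S_set_iff: "X \<in> S_set k \<longleftrightarrow> psd (real k *\<^sub>R diag_part X - X) \<and> psd X"
  by (auto simp: S_set_def loewner_ge_def psd_def)

section \<open>The hull lies in \<open>S_set\<close>\<close>

lemma convex_S_set: "convex (S_set k)"
proof (rule convexI)
  fix X Y :: "real^'n^'n" and u v :: real
  assume X: "X \<in> S_set k" and Y: "Y \<in> S_set k" and "0 \<le> u" "0 \<le> v" "u + v = 1"
  have "real k *\<^sub>R diag_part (u *\<^sub>R X + v *\<^sub>R Y) - (u *\<^sub>R X + v *\<^sub>R Y)
      = u *\<^sub>R (real k *\<^sub>R diag_part X - X) + v *\<^sub>R (real k *\<^sub>R diag_part Y - Y)"
    by (simp add: vec_eq_iff algebra_simps)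
  then show "u *\<^sub>R X + v *\<^sub>R Y \<in> S_set k"
    using X Y \<open>0 \<le> u\<close> \<open>0 \<le> v\<close> by (simp add: S_set_iff psd_add psd_scaleR)
qed

text \<open>Cauchy-Schwarz on the support of \<open>x\<close>, which has at most \<open>k\<close>
  elements.\<close>

lemma Q_set_subset_S_set: "Q_set k \<subseteq> S_set k"
proof
  fix X :: "real^'n^'n"
  assume "X \<in> Q_set k"
  then obtain x where X: "X = outer_product x x" and x: "norm0 x \<le> k"
    by (auto simp: Q_set_def)
  have "(x \<bullet> y)\<^sup>2 \<le> real k * (\<Sum>i\<in>UNIV. (x $ i * y $ i)\<^sup>2)" for y
  proof -
    let ?I = "{i. x $ i \<noteq> 0}"
    have "x \<bullet> y = (\<Sum>i\<in>?I. x $ i * y $ i)"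
      unfolding inner_vec_def inner_real_def by (rule sum.mono_neutral_right) auto
    then have "(x \<bullet> y)\<^sup>2 = (\<Sum>i\<in>?I. x $ i * y $ i)\<^sup>2" by simp
    also have "\<dots> \<le> (\<Sum>i\<in>?I. (x $ i * y $ i)\<^sup>2) * real (card ?I)"
      by (rule sum_squared_le_sum_of_squares)
    also have "\<dots> \<le> (\<Sum>i\<in>UNIV. (x $ i * y $ i)\<^sup>2) * real k"
      using x by (intro mult_mono sum_mono2) (auto simp: norm0_def intro: sum_nonneg)
    finally show ?thesis by (simp add: mult.commute)
  qed
  then have "psd (real k *\<^sub>R diag_part X - X)"
    by (simp add: psd_def symmetric_matrix_def transpose_def vec_eq_iff X inner_outer_product
        inner_diag_part matrix_vector_mult_diff_rdistrib inner_diff_right mult.commute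
        scaleR_matrix_vector_assoc [symmetric] power_mult_distrib power2_eq_square [of "x $ _"])
  then show "X \<in> S_set k"
    by (simp add: S_set_iff X psd_outer_product)
qed

lemma hull_Q_set_subset_S_set: "convex hull Q_set k \<subseteq> S_set k"
  by (rule hull_minimal) (use Q_set_subset_S_set convex_S_set in auto)

section \<open>The hull as a cone containing the 2 by 2 blocks\<close>

lemma scaleR_Q_set:
  assumes "X \<in> Q_set k" "0 \<le> c"
  shows "c *\<^sub>R X \<in> Q_set k"
proof -
  obtain x where X: "X = outer_product x x" and x: "norm0 x \<le> k"
    using assms by (auto simp: Q_set_def)
  have "norm0 (sqrt c *\<^sub>R x) \<le> norm0 x"
    by (auto simp: norm0_def intro: card_mono)
  moreover have "c *\<^sub>R X = outer_product (sqrt c *\<^sub>R x) (sqrt c *\<^sub>R x)"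
    using assms(2) by (simp add: X vec_eq_iff)
  ultimately show ?thesis
    using x unfolding Q_set_def by fastforce
qed

lemma hull_Q_set_add:
  assumes "X \<in> convex hull Q_set k" "Y \<in> convex hull Q_set k"
  shows "X + Y \<in> convex hull Q_set k"
proof -
  have "cone (convex hull (Q_set k :: (real^'n^'n) set))"
    by (rule cone_convex_hull) (simp add: cone_def scaleR_Q_set)
  then show ?thesis
    using assms by (metis convex_cone convex_convex_hull)
qed

text \<open>Completing the square writes the block as two rank-one terms if \<open>s > 0\<close>; if
  \<open>s = 0\<close>, then \<open>t = 0\<close> and one term is left.\<close>

lemma psd_block_in_hull_Q_set:
  fixes i j :: "'n::finite"
  assumes "0 \<le> s" "0 \<le> u" "t\<^sup>2 \<le> s * u"
  shows "(\<chi> k l. s * axis i 1 $ k * axis i 1 $ l + u * axis j 1 $ k * axis j 1 $ l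
      + t * (axis i 1 $ k * axis j 1 $ l + axis j 1 $ k * axis i 1 $ l))
    \<in> convex hull (Q_set 2 :: (real^'n^'n) set)" (is "?B \<in> _")
proof -
  have rank_one: "c *\<^sub>R outer_product (\<alpha> *\<^sub>R axis i 1 + \<beta> *\<^sub>R axis j 1) (\<alpha> *\<^sub>R axis i 1 + \<beta> *\<^sub>R axis j 1)
      \<in> convex hull (Q_set 2 :: (real^'n^'n) set)" if "0 \<le> c" for c \<alpha> \<beta> :: real
  proof -
    have "norm0 (\<alpha> *\<^sub>R axis i 1 + \<beta> *\<^sub>R axis j 1 :: real^'n) \<le> card {i, j}"
      unfolding norm0_def by (rule card_mono) (auto simp: axis_def split: if_splits)
    also have "\<dots> \<le> 2" by (simp add: card_insert_if)
    finally show ?thesis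
      using that by (intro hull_inc scaleR_Q_set) (auto simp: Q_set_def)
  qed
  show ?thesis
  proof (cases "s = 0")
    case True
    then have "t = 0" using assms by simp
    then have "?B = u *\<^sub>R outer_product (0 *\<^sub>R axis i 1 + 1 *\<^sub>R axis j 1) (0 *\<^sub>R axis i 1 + 1 *\<^sub>R axis j 1)"
      using True by (simp add: vec_eq_iff)
    then show ?thesis using rank_one [OF \<open>0 \<le> u\<close>] by metis
  next
    case False
    with assms have "0 \<le> u - t\<^sup>2 / s" by (simp add: field_simps)
    moreover have "?B = (1 / s) *\<^sub>R outer_product (s *\<^sub>R axis i 1 + t *\<^sub>R axis j 1) (s *\<^sub>R axis i 1 + t *\<^sub>R axis j 1)
        + (u - t\<^sup>2 / s) *\<^sub>R outer_product (0 *\<^sub>R axis i 1 + 1 *\<^sub>R axis j 1) (0 *\<^sub>R axis i 1 + 1 *\<^sub>R axis j 1)"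
      using False by (simp add: vec_eq_iff field_simps power2_eq_square)
    ultimately show ?thesis
      using \<open>0 \<le> s\<close> by (simp only: hull_Q_set_add rank_one divide_nonneg_nonneg zero_le_one)
  qed
qed

section \<open>Minors of nonnegative quadratic forms\<close>

lemma binary_form_nonneg_imp_discriminant:
  fixes p q a :: real
  assumes "\<And>x y. 0 \<le> p * x\<^sup>2 + q * y\<^sup>2 + 2 * a * x * y"
  shows "0 \<le> p" "0 \<le> q" "a\<^sup>2 \<le> p * q"
proof -
  show "0 \<le> p" using assms [of 1 0] by simp
  show "0 \<le> q" using assms [of 0 1] by simp
  show "a\<^sup>2 \<le> p * q"
  proof (cases "p = 0")
    case True
    \<comment> \<open>Without an \<open>x\<close>-square the form is linear in \<open>x\<close>;
      this point gives it the value \<open>- (q + 2)\<close> times the square of \<open>a\<close>,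
      so \<open>a = 0\<close>.\<close>
    have "0 \<le> - a\<^sup>2 * (2 * (q + 1) - q)"
      using assms [of "- (q + 1)" a] True by (simp add: algebra_simps power2_eq_square)
    with \<open>0 \<le> q\<close> have "a\<^sup>2 \<le> 0" by (simp add: mult_le_0_iff zero_le_mult_iff)
    then show ?thesis using True by simp
  next
    case False
    \<comment> \<open>On the line \<open>y = p\<close> the form is minimal at
      \<open>x = - a\<close>.\<close>
    have "0 \<le> p * (p * q - a\<^sup>2)"
      using assms [of "- a" p] by (simp add: algebra_simps power2_eq_square)
    then show ?thesis using False \<open>0 \<le> p\<close> by (simp add: zero_le_mult_iff)
  qed
qed

lemma ternary_form_nonneg_imp_minors:
  fixes p q r a b c :: real
  assumes form: "\<And>x y z. 0 \<le> p * x\<^sup>2 + q * y\<^sup>2 + r * z\<^sup>2 + 2 * a * x * y + 2 * b * x * z + 2 * c * y * z"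
  shows "0 \<le> p" "0 \<le> q" "0 \<le> r" "a\<^sup>2 \<le> p * q" "b\<^sup>2 \<le> p * r" "c\<^sup>2 \<le> q * r"
    "0 \<le> p * q * r + 2 * a * b * c - a\<^sup>2 * r - b\<^sup>2 * q - c\<^sup>2 * p"
proof -
  have "0 \<le> p * x\<^sup>2 + q * y\<^sup>2 + 2 * a * x * y" for x y using form [of x y 0] by simp
  note pq = binary_form_nonneg_imp_discriminant [OF this]
  have "0 \<le> p * x\<^sup>2 + r * y\<^sup>2 + 2 * b * x * y" for x y using form [of x 0 y] by simp
  note pr = binary_form_nonneg_imp_discriminant [OF this]
  have "0 \<le> q * x\<^sup>2 + r * y\<^sup>2 + 2 * c * x * y" for x y using form [of 0 x y] by simp
  note qr = binary_form_nonneg_imp_discriminant [OF this]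
  show "0 \<le> p" "0 \<le> q" "0 \<le> r" "a\<^sup>2 \<le> p * q" "b\<^sup>2 \<le> p * r" "c\<^sup>2 \<le> q * r"
    by fact+
  show "0 \<le> p * q * r + 2 * a * b * c - a\<^sup>2 * r - b\<^sup>2 * q - c\<^sup>2 * p"
  proof (cases "p = 0")
    case True
    then show ?thesis using pq pr by simp
  next
    case False
    with \<open>0 \<le> p\<close> have "0 < p" by simp
    \<comment> \<open>Minimising over the first variable leaves the form of the Schur complement, scaled by \<open>p\<close>.\<close>
    have "0 \<le> (p * q - a\<^sup>2) * y\<^sup>2 + (p * r - b\<^sup>2) * z\<^sup>2 + 2 * (p * c - a * b) * y * z" for y z
    proof -
      have "0 \<le> p * (p * (- (a * y + b * z) / p)\<^sup>2 + q * y\<^sup>2 + r * z\<^sup>2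
          + 2 * a * (- (a * y + b * z) / p) * y + 2 * b * (- (a * y + b * z) / p) * z + 2 * c * y * z)"
        by (rule mult_nonneg_nonneg [OF \<open>0 \<le> p\<close> form])
      also have "\<dots> = (p * q - a\<^sup>2) * y\<^sup>2 + (p * r - b\<^sup>2) * z\<^sup>2 + 2 * (p * c - a * b) * y * z"
        using \<open>0 < p\<close> by (simp add: field_simps power2_eq_square)
      finally show ?thesis .
    qed
    then have "(p * c - a * b)\<^sup>2 \<le> (p * q - a\<^sup>2) * (p * r - b\<^sup>2)"
      by (rule binary_form_nonneg_imp_discriminant)
    \<comment> \<open>The discriminant of the Schur complement form is \<open>p\<close> times the
      determinant.\<close>
    then have "0 \<le> p * (p * q * r + 2 * a * b * c - a\<^sup>2 * r - b\<^sup>2 * q - c\<^sup>2 * p)"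
      by (simp add: algebra_simps power2_eq_square)
    then show ?thesis using \<open>0 < p\<close> by (simp add: zero_le_mult_iff)
  qed
qed

section \<open>Splitting the diagonal among blocks\<close>

text \<open>Two blocks share only \<open>p\<close>. The first gets the least share it needs, and the
  determinant inequality divided by \<open>q\<close> says that the rest suffices for the
  second.\<close>

lemma diagonal_splitting_degenerate:
  fixes p q r a b :: real
  assumes "0 \<le> p" "0 \<le> q" "0 \<le> r" "a\<^sup>2 \<le> p * q" "b\<^sup>2 \<le> p * r"
    and det: "0 \<le> p * q * r - a\<^sup>2 * r - b\<^sup>2 * q"
  obtains p' where "0 \<le> p'" "p' \<le> p" "a\<^sup>2 \<le> p' * q" "b\<^sup>2 \<le> (p - p') * r"
proof (cases "q = 0")
  case True
  then show ?thesis using that [of 0] assms by simp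
next
  case False
  with assms have "0 < q" by simp
  show ?thesis
  proof (rule that [of "a\<^sup>2 / q"])
    show "b\<^sup>2 \<le> (p - a\<^sup>2 / q) * r"
      using det \<open>0 < q\<close> by (simp add: field_simps)
  qed (use \<open>0 < q\<close> assms in \<open>auto simp: field_simps\<close>)
qed

text \<open>If \<open>a\<close>, \<open>b\<close>, \<open>c\<close> are positive, block
  \<open>{i, j}\<close> with off-diagonal entry \<open>m\<close> gets the shares
  \<open>m * vj / vi\<close> and \<open>m * vi / vj\<close>, whose product is the square of
  \<open>m\<close>. Row \<open>i\<close> of \<open>M v \<ge> 0\<close>, divided by
  \<open>vi\<close>, says that the shares fit into the diagonal entry.\<close>

lemma diagonal_splitting:
  fixes p q r a b c :: real
  assumes nonneg: "0 \<le> p" "0 \<le> q" "0 \<le> r" "0 \<le> a" "0 \<le> b" "0 \<le> c"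
    and minors: "a\<^sup>2 \<le> p * q" "b\<^sup>2 \<le> p * r" "c\<^sup>2 \<le> q * r"
    and det: "0 \<le> p * q * r - 2 * a * b * c - a\<^sup>2 * r - b\<^sup>2 * q - c\<^sup>2 * p"
  obtains p' q' r' where "0 \<le> p'" "p' \<le> p" "0 \<le> q'" "q' \<le> q" "0 \<le> r'" "r' \<le> r"
    "a\<^sup>2 \<le> p' * q'" "b\<^sup>2 \<le> (p - p') * r'" "c\<^sup>2 \<le> (q - q') * (r - r')"
proof -
  consider "a = 0" | "b = 0" | "c = 0" | "0 < a" "0 < b" "0 < c"
    using nonneg by linarith
  then show thesis
  proof cases
    \<comment> \<open>The block with entry \<open>a\<close> needs no share, so only \<open>r\<close>
      has to be split; the next two cases likewise split \<open>q\<close> and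
      \<open>p\<close>.\<close>
    case 1
    obtain r' where "0 \<le> r'" "r' \<le> r" "b\<^sup>2 \<le> r' * p" "c\<^sup>2 \<le> (r - r') * q"
      by (rule diagonal_splitting_degenerate [of r p q b c])
        (use assms 1 in \<open>auto simp: mult_ac\<close>)
    then show thesis using that [of 0 0 r'] assms 1 by (simp add: mult_ac)
  next
    case 2
    obtain q' where "0 \<le> q'" "q' \<le> q" "a\<^sup>2 \<le> q' * p" "c\<^sup>2 \<le> (q - q') * r"
      by (rule diagonal_splitting_degenerate [of q p r a c])
        (use assms 2 in \<open>auto simp: mult_ac\<close>)
    then show thesis using that [of p q' 0] assms 2 by (simp add: mult_ac)
  next
    case 3
    obtain p' where "0 \<le> p'" "p' \<le> p" "a\<^sup>2 \<le> p' * q" "b\<^sup>2 \<le> (p - p') * r"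
      by (rule diagonal_splitting_degenerate [of p q r a b])
        (use assms 3 in \<open>auto simp: mult_ac\<close>)
    then show thesis using that [of p' q r] assms 3 by (simp add: mult_ac)
  next
    case 4
    have "0 < a\<^sup>2" "0 < c\<^sup>2" using 4 by simp_all
    then have "p \<noteq> 0" "q \<noteq> 0" "r \<noteq> 0" using minors by auto
    then have "0 < p" "0 < q" "0 < r" using nonneg by simp_all
    \<comment> \<open>This makes \<open>v1\<close> strictly positive, as needed to divide by
      it.\<close>
    have "c\<^sup>2 \<noteq> q * r"
    proof
      assume "c\<^sup>2 = q * r"
      then have "p * q * r - c\<^sup>2 * p = 0" by simp
      moreover have "0 < 2 * a * b * c" "0 < a\<^sup>2 * r" "0 < b\<^sup>2 * q"
        using 4 \<open>0 < q\<close> \<open>0 < r\<close> by simp_all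
      ultimately show False using det by linarith
    qed
    \<comment> \<open>The first column of the adjugate of the comparison matrix \<open>M\<close>, so that
      \<open>M v = (det M, 0, 0)\<close>.\<close>
    define v1 v2 v3 where "v1 = q * r - c\<^sup>2" and "v2 = a * r + b * c" and "v3 = a * c + b * q"
    have v: "0 < v1" "0 < v2" "0 < v3"
      using 4 \<open>0 < q\<close> \<open>0 < r\<close> \<open>c\<^sup>2 \<noteq> q * r\<close> minors by (auto simp: v1_def v2_def v3_def add_pos_pos)
    have Mv: "a * v2 + b * v3 \<le> p * v1" "q * v2 = a * v1 + c * v3" "r * v3 = b * v1 + c * v2"
      using det by (simp_all add: v1_def v2_def v3_def algebra_simps power2_eq_square)
    have p: "b * v3 / v1 \<le> p - a * v2 / v1" using Mv(1) v by (simp add: field_simps)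
    have q: "q - a * v1 / v2 = c * v3 / v2" using Mv(2) v by (simp add: field_simps)
    have r: "r - b * v1 / v3 = c * v2 / v3" using Mv(3) v by (simp add: field_simps)
    have "0 \<le> b * v3 / v1" "0 \<le> c * v3 / v2" "0 \<le> c * v2 / v3" using nonneg v by simp_all
    show thesis
    proof (rule that [of "a * v2 / v1" "a * v1 / v2" "b * v1 / v3"])
      have "b\<^sup>2 = (b * v3 / v1) * (b * v1 / v3)" using v by (simp add: power2_eq_square)
      also have "\<dots> \<le> (p - a * v2 / v1) * (b * v1 / v3)"
        using p nonneg v by (intro mult_right_mono) simp_all
      finally show "b\<^sup>2 \<le> (p - a * v2 / v1) * (b * v1 / v3)" .
      show "c\<^sup>2 \<le> (q - a * v1 / v2) * (r - b * v1 / v3)"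
        unfolding q r using v by (simp add: power2_eq_square)
      show "a * v2 / v1 \<le> p" using p \<open>0 \<le> b * v3 / v1\<close> by linarith
      show "a * v1 / v2 \<le> q" using q \<open>0 \<le> c * v3 / v2\<close> by linarith
      show "b * v1 / v3 \<le> r" using r \<open>0 \<le> c * v2 / v3\<close> by linarith
    qed (use nonneg v in \<open>auto simp: power2_eq_square\<close>)
  qed
qed

section \<open>Equality in dimension 3\<close>

lemma quadratic_form_3:
  fixes X :: "real^3^3"
  assumes "symmetric_matrix X"
  shows "vector [x, y, z] \<bullet> (X *v vector [x, y, z]) =
    X $ 1 $ 1 * x\<^sup>2 + X $ 2 $ 2 * y\<^sup>2 + X $ 3 $ 3 * z\<^sup>2
    + 2 * X $ 1 $ 2 * x * y + 2 * X $ 1 $ 3 * x * z + 2 * X $ 2 $ 3 * y * z"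
proof -
  have "X $ 2 $ 1 = X $ 1 $ 2" "X $ 3 $ 1 = X $ 1 $ 3" "X $ 3 $ 2 = X $ 2 $ 3"
    using assms by (auto simp: symmetric_matrix_def transpose_def vec_eq_iff)
  then show ?thesis
    by (simp add: matrix_vector_mult_def inner_vec_def sum_3 algebra_simps power2_eq_square)
qed

lemma S_set_subset_hull_Q_set_3: "S_set 2 \<subseteq> convex hull (Q_set 2 :: (real^3^3) set)"
proof
  fix X :: "real^3^3"
  assume "X \<in> S_set 2"
  then have X: "psd X" and Y: "psd (2 *\<^sub>R diag_part X - X)"
    by (simp_all add: S_set_iff)
  define p q r a b c where "p = X $ 1 $ 1" and "q = X $ 2 $ 2" and "r = X $ 3 $ 3"
    and "a = X $ 1 $ 2" and "b = X $ 1 $ 3" and "c = X $ 2 $ 3"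
  have sym: "X $ 2 $ 1 = a" "X $ 3 $ 1 = b" "X $ 3 $ 2 = c"
    using X by (auto simp: psd_def symmetric_matrix_def transpose_def vec_eq_iff a_def b_def c_def)
  have "0 \<le> p * x\<^sup>2 + q * y\<^sup>2 + r * z\<^sup>2 + 2 * a * x * y + 2 * b * x * z + 2 * c * y * z" for x y z
  proof -
    have "0 \<le> vector [x, y, z] \<bullet> (X *v vector [x, y, z])" and "symmetric_matrix X"
      using X by (auto simp: psd_def)
    then show ?thesis
      by (simp add: quadratic_form_3 p_def q_def r_def a_def b_def c_def)
  qed
  note minors = ternary_form_nonneg_imp_minors [OF this]
  have "0 \<le> p * x\<^sup>2 + q * y\<^sup>2 + r * z\<^sup>2 + 2 * (- a) * x * y + 2 * (- b) * x * z + 2 * (- c) * y * z"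
    for x y z
  proof -
    let ?Y = "2 *\<^sub>R diag_part X - X"
    have "0 \<le> vector [x, y, z] \<bullet> (?Y *v vector [x, y, z])" and "symmetric_matrix ?Y"
      using Y unfolding psd_def by blast+
    then show ?thesis
      by (simp add: quadratic_form_3 p_def q_def r_def a_def b_def c_def)
  qed
  from ternary_form_nonneg_imp_minors(7) [OF this] minors(7)
  have "0 \<le> p * q * r - 2 * \<bar>a\<bar> * \<bar>b\<bar> * \<bar>c\<bar> - a\<^sup>2 * r - b\<^sup>2 * q - c\<^sup>2 * p"
    by (cases "0 \<le> a"; cases "0 \<le> b"; cases "0 \<le> c") simp_all
  then obtain p' q' r' where split: "0 \<le> p'" "p' \<le> p" "0 \<le> q'" "q' \<le> q" "0 \<le> r'" "r' \<le> r"
    "a\<^sup>2 \<le> p' * q'" "b\<^sup>2 \<le> (p - p') * r'" "c\<^sup>2 \<le> (q - q') * (r - r')"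
    by (rule diagonal_splitting [of p q r "\<bar>a\<bar>" "\<bar>b\<bar>" "\<bar>c\<bar>", unfolded power2_abs,
          OF minors(1-3) abs_ge_zero abs_ge_zero abs_ge_zero minors(4-6)])
  have "(\<chi> k l. p' * axis 1 1 $ k * axis 1 1 $ l + q' * axis 2 1 $ k * axis 2 1 $ l
        + a * (axis 1 1 $ k * axis 2 1 $ l + axis 2 1 $ k * axis 1 1 $ l))
      + (\<chi> k l. (p - p') * axis 1 1 $ k * axis 1 1 $ l + r' * axis 3 1 $ k * axis 3 1 $ l
        + b * (axis 1 1 $ k * axis 3 1 $ l + axis 3 1 $ k * axis 1 1 $ l))
      + (\<chi> k l. (q - q') * axis 2 1 $ k * axis 2 1 $ l + (r - r') * axis 3 1 $ k * axis 3 1 $ l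
        + c * (axis 2 1 $ k * axis 3 1 $ l + axis 3 1 $ k * axis 2 1 $ l))
      \<in> convex hull (Q_set 2 :: (real^3^3) set)" (is "?Z \<in> _")
    by (intro hull_Q_set_add psd_block_in_hull_Q_set) (simp_all add: split)
  moreover have "X = ?Z"
    by (simp add: vec_eq_iff forall_3 axis_def sym p_def q_def r_def a_def b_def c_def
        sym [unfolded a_def b_def c_def])
  ultimately show "X \<in> convex hull Q_set 2" by simp
qed

section \<open>Strict inclusion in dimension at least 4\<close>

text \<open>At most two of the four coordinates are nonzero, so at most one edge product survives,
  and the squares of its two factors dominate it.\<close>

lemma signed_cycle_form_nonneg:
  fixes x :: "real^'n"
  assumes "norm0 x \<le> 2" and distinct: "distinct [i, j, k, l]"
  shows "0 \<le> (x $ i)\<^sup>2 + (x $ j)\<^sup>2 + (x $ k)\<^sup>2 + (x $ l)\<^sup>2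
    - 2 * (x $ i * x $ j + x $ j * x $ k + x $ k * x $ l - x $ i * x $ l)"
proof -
  have no_three: False
    if "distinct [s, t, u]" "x $ s \<noteq> 0" "x $ t \<noteq> 0" "x $ u \<noteq> 0" for s t u
  proof -
    have "card {s, t, u} \<le> norm0 x"
      unfolding norm0_def using that by (intro card_mono) auto
    then show False using that assms(1) by simp
  qed
  have "x $ i = 0 \<and> x $ j = 0 \<or> x $ i = 0 \<and> x $ k = 0 \<or> x $ i = 0 \<and> x $ l = 0
      \<or> x $ j = 0 \<and> x $ k = 0 \<or> x $ j = 0 \<and> x $ l = 0 \<or> x $ k = 0 \<and> x $ l = 0"
    using no_three [of i j k] no_three [of i j l] no_three [of i k l] no_three [of j k l] distinct
    by auto
  moreover have "2 * (s * t) \<le> s\<^sup>2 + t\<^sup>2" "- (2 * (s * t)) \<le> s\<^sup>2 + t\<^sup>2" for s t :: real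
    using zero_le_power2 [of "s - t"] zero_le_power2 [of "s + t"]
    by (simp_all add: power2_diff power2_sum)
  ultimately show ?thesis by auto
qed

lemma hull_Q_set_psubset_S_set:
  assumes "CARD('n::finite) \<ge> 4"
  shows "convex hull (Q_set 2 :: (real^'n^'n) set) \<subset> S_set 2"
proof -
  obtain T :: "'n set" where "card T = 4"
    using assms obtain_subset_with_card_n by metis
  then obtain i j k l :: 'n where distinct: "distinct [i, j, k, l]"
    by (auto simp: card_Suc_eq numeral_eq_Suc)
  \<comment> \<open>For symmetric \<open>Y\<close> this is the separating functional, with trace and
    cycle restricted to the four chosen indices; the edge between \<open>i\<close> and
    \<open>l\<close> is the negative one.\<close>
  define L :: "real^'n^'n \<Rightarrow> real" where "L Y = Y $ i $ i + Y $ j $ j + Y $ k $ k + Y $ l $ l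
    - 2 * (Y $ i $ j + Y $ j $ k + Y $ k $ l - Y $ i $ l)" for Y
  \<comment> \<open>For \<open>\<epsilon> = \<plusminus>1\<close> the vectors are the rows of \<open>I + \<epsilon> A\<close>, so \<open>W \<epsilon> = (I + \<epsilon> A)\<^sup>2 = 3I + 2 \<epsilon> A\<close>.\<close>
  define W :: "real \<Rightarrow> real^'n^'n" where "W \<epsilon> =
      (let u1 = axis i 1 + \<epsilon> *\<^sub>R (axis j 1 - axis l 1); u2 = axis j 1 + \<epsilon> *\<^sub>R (axis i 1 + axis k 1);
           u3 = axis k 1 + \<epsilon> *\<^sub>R (axis j 1 + axis l 1); u4 = axis l 1 + \<epsilon> *\<^sub>R (axis k 1 - axis i 1)
       in outer_product u1 u1 + outer_product u2 u2 + outer_product u3 u3 + outer_product u4 u4)" for \<epsilon>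
  have psd_W: "psd (W \<epsilon>)" for \<epsilon>
    by (simp add: W_def Let_def psd_add psd_outer_product)
  \<comment> \<open>On the diagonal this kills the cross terms of the outer products, off the
    diagonal the squares.\<close>
  have axis_mult: "axis m (1::real) $ s * axis n 1 $ t = 0" if "m = n \<longleftrightarrow> s \<noteq> t" for m n s t :: 'n
    using that by (auto simp: axis_def)
  have "(2 *\<^sub>R diag_part (W 1) - W 1) $ s $ t = W (- 1) $ s $ t" for s t
    using distinct by (cases "s = t") (simp_all add: W_def Let_def algebra_simps axis_mult)
  then have "2 *\<^sub>R diag_part (W 1) - W 1 = W (- 1)"
    by (simp add: vec_eq_iff)
  then have "W 1 \<in> S_set 2"
    by (simp add: S_set_iff psd_W)
  moreover have "W 1 \<notin> convex hull Q_set 2"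
  proof
    have "convex {Y. 0 \<le> L Y}"
    proof (rule convexI)
      fix Y Z :: "real^'n^'n" and u v :: real
      assume *: "Y \<in> {Y. 0 \<le> L Y}" "Z \<in> {Y. 0 \<le> L Y}" "0 \<le> u" "0 \<le> v" "u + v = 1"
      have "L (u *\<^sub>R Y + v *\<^sub>R Z) = u * L Y + v * L Z"
        by (simp add: L_def algebra_simps)
      then show "u *\<^sub>R Y + v *\<^sub>R Z \<in> {Y. 0 \<le> L Y}" using * by simp
    qed
    moreover have "Q_set 2 \<subseteq> {Y. 0 \<le> L Y}"
      using signed_cycle_form_nonneg [OF _ distinct]
      by (auto simp: Q_set_def L_def power2_eq_square)
    ultimately have hull: "convex hull Q_set 2 \<subseteq> {Y. 0 \<le> L Y}"
      by (simp add: hull_minimal)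
    have "L (W 1) = - 4"
      using distinct by (auto simp: L_def W_def Let_def axis_def)
    moreover assume "W 1 \<in> convex hull Q_set 2"
    ultimately show False using hull by auto
  qed
  ultimately show ?thesis using hull_Q_set_subset_S_set by blast
qed

theorem theorem2p1:
  shows "convex hull (Q_set 2 :: (real^3^3) set) = S_set 2 \<and>
    (CARD('n::finite) \<ge> 4 \<longrightarrow> convex hull (Q_set 2 :: (real^'n^'n) set) \<subset> S_set 2)"
proof (intro conjI impI)
  show "convex hull (Q_set 2 :: (real^3^3) set) = S_set 2"
    by (rule subset_antisym [OF hull_Q_set_subset_S_set S_set_subset_hull_Q_set_3])
qed (rule hull_Q_set_psubset_S_set)

end
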